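(* Let $t_1,t_2,r_1,r_2$ be positive integers and let $H_{iq}$, $i,q\in\{1,2\}$, be mutually independent random matrices defined on the same probability space $(\Omega,\mathcal{F},P)$, with $H_{iq}$ taking values in $\mathbb{C}^{r_i\times t_q}$, such that $\mathrm{vec}(H_{ii})$ is a continuous random vector for $i=1,2$. For $i\ne j$ in $\{1,2\}$ with $t_i>r_j$, let $d_i=\operatorname{rank}(H_{ii})$ and $d_i^{n}=\operatorname{rank}(\tilde H_{ii})$, where $\tilde H_{ii}=H_{ii}T_i$ and $T_i$ is user $i$'s $t_i\times(t_i-r_j)$ pre-coding matrix, whose columns are orthonormal eigenvectors of $G_i=H_{ji}^*H_{ji}$ belonging to its null space, as defined in the context. If $t_i\ge r_i+r_j$, then $d_i=d_i^{n}$ almost surely.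
   Context: A $t$-dimensional complex random vector $x=x_{\mathrm{Re}}+i\,x_{\mathrm{Im}}$ (with $x_{\mathrm{Re}},x_{\mathrm{Im}}$ real) is called continuous if the $2t$-dimensional real random vector $[x_{\mathrm{Re}}^{T},x_{\mathrm{Im}}^{T}]$ has a probability density function with respect to Lebesgue measure on $\mathbb{R}^{2t}$. $\mathrm{vec}(\cdot)$ stacks the columns of a matrix into one vector. Pre-coding matrix: for $i\neq j$ in $\{1,2\}$ with $t_i>r_j$, let $G_i=H_{ji}^*H_{ji}\in\mathbb{C}^{t_i\times t_i}$ and let $G_i=W_i\Lambda_iW_i^*$ be its eigenvalue decomposition, with $W_i$ unitary and $\Lambda_i$ diagonal. Then $T_i=[w_{q_1},\dots,w_{q_{t_i-r_j}}]$, where $w_q$ is the $q$-th column of $W_i$ and $q_1,\dots,q_{t_i-r_j}$ are distinct indices selecting eigenvectors in the null space of $G_i$, i.e. $w_{q_k}^*G_iw_{q_k}=0$ for $k=1,\dots,t_i-r_j$. The decomposition and the choice of indices are determined from $G_i$ alone, so that $T_i$ is a measurable function of $G_i$. Here $^*$ denotes conjugate transpose. *)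

theory Defs
  imports "HOL-Probability.Probability" "Jordan_Normal_Form.Schur_Decomposition"
    "Jordan_Normal_Form.DL_Rank"
begin

text \<open>The Borel space on complex \<open>m \<times> n\<close> matrices, identified with their families of entries.\<close>

definition mat_borel :: "nat \<Rightarrow> nat \<Rightarrow> complex mat measure" where
  "mat_borel m n = vimage_algebra (carrier_mat m n)
     (\<lambda>A. \<lambda>p\<in>{..<m} \<times> {..<n}. A $$ p) (\<Pi>\<^sub>M p\<in>{..<m} \<times> {..<n}. borel)"

text \<open>The vectorization stacks the columns of a matrix.\<close>

definition vec_of_mat :: "'b mat \<Rightarrow> 'b vec" where
  "vec_of_mat A = Matrix.vec (dim_row A * dim_col A)
     (\<lambda>k. A $$ (k mod dim_row A, k div dim_row A))"

text \<open>The real vector \<open>[Re x, Im x]\<close> of length \<open>2 * n\<close> for \<open>x\<close> of length \<open>n\<close>; such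
  vectors are represented as functions on \<open>{..<2 * n}\<close>, for which \<open>\<Pi>\<^sub>M k\<in>{..<2 * n}. lborel\<close>
  is Lebesgue measure.\<close>

definition re_im :: "nat \<Rightarrow> complex vec \<Rightarrow> nat \<Rightarrow> real" where
  "re_im n x = (\<lambda>k\<in>{..<2 * n}. if k < n then Re (vec_index x k) else Im (vec_index x (k - n)))"

definition continuous_rvec :: "'a measure \<Rightarrow> nat \<Rightarrow> ('a \<Rightarrow> complex vec) \<Rightarrow> bool" where
  "continuous_rvec M n X \<longleftrightarrow> (\<forall>\<omega>\<in>space M. X \<omega> \<in> carrier_vec n) \<and>
     (\<exists>f. distributed M (\<Pi>\<^sub>M k\<in>{..<2 * n}. lborel) (\<lambda>\<omega>. re_im n (X \<omega>)) f)"

definition gram :: "complex mat \<Rightarrow> complex mat" where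
  "gram A = mat_adjoint A * A"

definition unitary_mat :: "nat \<Rightarrow> complex mat \<Rightarrow> bool" where
  "unitary_mat n W \<longleftrightarrow> W \<in> carrier_mat n n \<and>
     mat_adjoint W * W = 1\<^sub>m n \<and> W * mat_adjoint W = 1\<^sub>m n"

definition eigenvalue_decomposition ::
    "nat \<Rightarrow> complex mat \<Rightarrow> complex mat \<Rightarrow> complex mat \<Rightarrow> bool" where
  "eigenvalue_decomposition n G W L \<longleftrightarrow>
     unitary_mat n W \<and> L \<in> carrier_mat n n \<and> diagonal_mat L \<and> G = W * L * mat_adjoint W"

text \<open>Indices are counted from 0. The scalar \<open>w\<^sup>* G w\<close> is written \<open>(G *\<^sub>v w) \<bullet>c w\<close>.\<close>

definition selects_null_columns ::
    "nat \<Rightarrow> nat \<Rightarrow> complex mat \<Rightarrow> complex mat \<Rightarrow> (nat \<Rightarrow> nat) \<Rightarrow> bool" where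
  "selects_null_columns n k G W q \<longleftrightarrow>
     inj_on q {..<k} \<and> q ` {..<k} \<subseteq> {..<n} \<and>
     (\<forall>l<k. (G *\<^sub>v col W (q l)) \<bullet>c col W (q l) = 0)"

text \<open>The pre-coding matrix as a function of \<open>G\<close>: both the eigenvector matrix \<open>W G\<close> and the
  selected column indices \<open>q G 0, \<dots>, q G (k - 1)\<close> depend on \<open>G\<close> only.\<close>

definition precoder ::
    "nat \<Rightarrow> nat \<Rightarrow> (complex mat \<Rightarrow> complex mat) \<Rightarrow> (complex mat \<Rightarrow> nat \<Rightarrow> nat) \<Rightarrow>
     complex mat \<Rightarrow> complex mat" where
  "precoder n k W q G = mat_of_cols n (map (\<lambda>l. col (W G) (q G l)) [0..<k])"

end

theory Submission
  imports Defs "Jordan_Normal_Form.Spectral_Radius"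
begin

text \<open>Both ranks are almost surely equal to \<open>r\<^sub>i\<close>. Let \<open>T\<close> consist of the first \<open>r\<^sub>i\<close> columns of the
  pre-coding matrix, which exist because \<open>r\<^sub>i \<le> t\<^sub>i - r\<^sub>j\<close>. If \<open>det (X T) \<noteq> 0\<close>, then both
  \<open>X = H\<^sub>i\<^sub>i\<close> and its product with the whole pre-coding matrix have a right inverse, hence full row
  rank. As \<open>T\<close> is independent of \<open>X\<close>, it suffices that for every fixed \<open>T\<close> with a left inverse
  \<open>B\<close> the set of all \<open>X\<close> with \<open>det (X T) = 0\<close> has Lebesgue measure zero, and this holds because
  every line in the direction \<open>B\<close> meets it in finitely many points.\<close>

section \<open>Measurability of matrix operations\<close>

lemma space_mat_borel [simp]: "space (mat_borel m n) = carrier_mat m n"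
  by (simp add: mat_borel_def)

lemma measurable_mat_entry:
  assumes "a < m" "b < n"
  shows "(\<lambda>A. A $$ (a, b)) \<in> borel_measurable (mat_borel m n)"
proof -
  have "(\<lambda>A. \<lambda>p\<in>{..<m} \<times> {..<n}. A $$ p) \<in> mat_borel m n \<rightarrow>\<^sub>M (\<Pi>\<^sub>M p\<in>{..<m} \<times> {..<n}. borel)"
    unfolding mat_borel_def by (rule measurable_vimage_algebra1) (auto simp: space_PiM)
  from measurable_comp[OF this measurable_component_singleton[of "(a, b)"]] assms
  show ?thesis by (simp add: comp_def)
qed

text \<open>\<open>mat_borel\<close> is the initial sigma-algebra of the entry map on matrices of
  fixed size, so measurability into it can be checked entry by entry.\<close>

lemma measurable_mat_borelI:
  assumes "\<And>x. x \<in> space N \<Longrightarrow> F x \<in> carrier_mat m n"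
    and "\<And>a b. a < m \<Longrightarrow> b < n \<Longrightarrow> (\<lambda>x. F x $$ (a, b)) \<in> borel_measurable N"
  shows "F \<in> N \<rightarrow>\<^sub>M mat_borel m n"
  unfolding mat_borel_def
  by (rule measurable_vimage_algebra2) (use assms in \<open>auto intro!: measurable_restrict\<close>)

lemma borel_measurable_mat_entry:
  assumes "F \<in> N \<rightarrow>\<^sub>M mat_borel m n" "a < m" "b < n"
  shows "(\<lambda>x. F x $$ (a, b)) \<in> borel_measurable N"
  using measurable_comp[OF assms(1) measurable_mat_entry[OF assms(2,3)]] by (simp add: comp_def)

lemma measurable_mat_mult:
  assumes F: "F \<in> N \<rightarrow>\<^sub>M mat_borel m k" and G: "G \<in> N \<rightarrow>\<^sub>M mat_borel k n"
  shows "(\<lambda>x. F x * G x) \<in> N \<rightarrow>\<^sub>M mat_borel m n"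
proof (rule measurable_mat_borelI)
  have c: "F x \<in> carrier_mat m k" "G x \<in> carrier_mat k n" if "x \<in> space N" for x
    using measurable_space[OF F that] measurable_space[OF G that] by auto
  then show "F x * G x \<in> carrier_mat m n" if "x \<in> space N" for x
    using that by (meson mult_carrier_mat)
  fix a b assume ab: "a < m" "b < n"
  have "(\<lambda>x. \<Sum>l = 0..<k. F x $$ (a, l) * G x $$ (l, b)) \<in> borel_measurable N"
    using ab by (intro borel_measurable_sum borel_measurable_times
        borel_measurable_mat_entry[OF F] borel_measurable_mat_entry[OF G]) auto
  then show "(\<lambda>x. (F x * G x) $$ (a, b)) \<in> borel_measurable N"
  proof (rule measurable_cong[THEN iffD1, rotated])
    fix x assume "x \<in> space N"
    with c[of x] ab show "(\<Sum>l = 0..<k. F x $$ (a, l) * G x $$ (l, b)) = (F x * G x) $$ (a, b)"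
      by (auto simp: scalar_prod_def)
  qed
qed

lemma mat_adjoint_dim [simp]:
  "dim_row (mat_adjoint A) = dim_col A" "dim_col (mat_adjoint A) = dim_row A"
  by (simp_all add: mat_adjoint_def)

lemma mat_adjoint_carrier: "A \<in> carrier_mat m n \<Longrightarrow> mat_adjoint A \<in> carrier_mat n m"
  by auto

lemma mat_adjoint_index:
  "a < dim_col A \<Longrightarrow> b < dim_row A \<Longrightarrow> mat_adjoint A $$ (a, b) = conjugate (A $$ (b, a))"
  by (simp add: mat_adjoint_def mat_of_rows_def)

lemma measurable_mat_adjoint:
  assumes F: "F \<in> N \<rightarrow>\<^sub>M mat_borel m n"
  shows "(\<lambda>x. mat_adjoint (F x)) \<in> N \<rightarrow>\<^sub>M mat_borel n m"
proof (rule measurable_mat_borelI)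
  have c: "F x \<in> carrier_mat m n" if "x \<in> space N" for x
    using measurable_space[OF F that] by auto
  then show "mat_adjoint (F x) \<in> carrier_mat n m" if "x \<in> space N" for x
    using that mat_adjoint_carrier by blast
  fix a b assume ab: "a < n" "b < m"
  have "(\<lambda>x. cnj (F x $$ (b, a))) \<in> borel_measurable N"
    using borel_measurable_mat_entry[OF F ab(2,1)]
    by (rule borel_measurable_continuous_on[rotated]) (intro continuous_intros)
  then show "(\<lambda>x. mat_adjoint (F x) $$ (a, b)) \<in> borel_measurable N"
    by (rule measurable_cong[THEN iffD1, rotated])
      (use ab in \<open>auto simp: mat_adjoint_index dest!: c\<close>)
qed

lemma measurable_gram: "gram \<in> mat_borel m n \<rightarrow>\<^sub>M mat_borel n n"
  unfolding gram_def
  by (rule measurable_mat_mult[OF measurable_mat_adjoint[OF measurable_ident] measurable_ident,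
        unfolded id_def])

text \<open>By the Leibniz formula the determinant is a polynomial in the entries.\<close>

lemma borel_measurable_det:
  assumes F: "F \<in> N \<rightarrow>\<^sub>M mat_borel n n"
  shows "(\<lambda>x. Determinant.det (F x)) \<in> borel_measurable N"
proof -
  have "(\<lambda>x. \<Sum>p\<in>{p. p permutes {0..<n}}. signof p * (\<Prod>a = 0..<n. F x $$ (a, p a)))
      \<in> borel_measurable N"
    by (intro borel_measurable_sum borel_measurable_times borel_measurable_prod
        borel_measurable_const borel_measurable_mat_entry[OF F])
      (auto simp: permutes_in_image)
  then show ?thesis
  proof (rule measurable_cong[THEN iffD1, rotated])
    fix x assume "x \<in> space N"
    then have "F x \<in> carrier_mat n n" using measurable_space[OF F] by simp
    then show "(\<Sum>p\<in>{p. p permutes {0..<n}}. signof p * (\<Prod>a = 0..<n. F x $$ (a, p a)))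
        = Determinant.det (F x)"
      by (rule det_def'[symmetric])
  qed
qed

section \<open>Criteria for full row rank\<close>

text \<open>Each \<open>v\<close> equals \<open>A (B v)\<close>, so the columns of \<open>A\<close>
  span the whole space.\<close>

lemma rank_eq_if_right_inverse:
  fixes A :: "complex mat"
  assumes A: "A \<in> carrier_mat n m" and B: "B \<in> carrier_mat m n" and AB: "A * B = 1\<^sub>m n"
  shows "vec_space.rank n A = n"
proof -
  interpret vec_space "TYPE(complex)" n .
  have "v \<in> col_space A" if v: "v \<in> carrier_vec n" for v
  proof -
    have "A *\<^sub>v (B *\<^sub>v v) = v"
      using assoc_mult_mat_vec[OF A B v] AB v by simp
    with B v A show ?thesis unfolding col_space_eq[OF A] by (auto intro!: bexI[of _ "B *\<^sub>v v"])
  qed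
  then have "span (set (cols A)) = carrier_vec n"
    using col_space_eq[OF A] A unfolding col_space_def by auto
  then have "span_vs (set (cols A)) = V"
    by (simp add: module_vec_def)
  then show ?thesis unfolding rank_def using dim_is_n by simp
qed

text \<open>If \<open>C\<close> inverts \<open>A * B\<close>, then \<open>B * C\<close> is a right
  inverse of \<open>A\<close>.\<close>

lemma rank_eq_if_det_nonzero:
  fixes A :: "complex mat"
  assumes A: "A \<in> carrier_mat n m" and B: "B \<in> carrier_mat m n"
    and det: "Determinant.det (A * B) \<noteq> 0"
  shows "vec_space.rank n A = n"
proof -
  have AB: "A * B \<in> carrier_mat n n" using A B by simp
  \<comment> \<open>The argument \<open>()\<close> merely fills the extension slot of the matrix
    ring record.\<close>
  from det_non_zero_imp_unit[OF AB det, of "()"]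
  obtain C where C: "C \<in> carrier_mat n n" "A * B * C = 1\<^sub>m n"
    unfolding Units_def ring_mat_def by auto
  then have "A * (B * C) = 1\<^sub>m n" using assoc_mult_mat[OF A B C(1)] by simp
  with A B C(1) show ?thesis by (meson rank_eq_if_right_inverse mult_carrier_mat)
qed

section \<open>Lebesgue null sets and translations\<close>

text \<open>A product measure is determined by its values on boxes. Translation pulls a box back to
  a box, and each side keeps its length by invariance of \<open>lborel\<close> on the line.\<close>

lemma PiM_lborel_translation:
  fixes c :: "'i \<Rightarrow> real"
  assumes I: "finite I"
  shows "distr (\<Pi>\<^sub>M i\<in>I. lborel) (\<Pi>\<^sub>M i\<in>I. lborel) (\<lambda>x. \<lambda>i\<in>I. x i + c i)
    = (\<Pi>\<^sub>M i\<in>I. (lborel :: real measure))"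
proof -
  interpret product_sigma_finite "\<lambda>_::'i. lborel :: real measure" ..
  have T: "(\<lambda>x. \<lambda>i\<in>I. x i + c i) \<in> (\<Pi>\<^sub>M i\<in>I. lborel) \<rightarrow>\<^sub>M (\<Pi>\<^sub>M i\<in>I. lborel :: real measure)"
    by (intro measurable_restrict) measurable
  show ?thesis
  proof (rule PiM_eqI[OF I])
    fix A :: "'i \<Rightarrow> real set" assume A: "\<And>i. i \<in> I \<Longrightarrow> A i \<in> sets lborel"
    let ?B = "\<lambda>i. (+) (c i) -` A i"
    have B: "?B i \<in> sets lborel" if "i \<in> I" for i
      using A[OF that] measurable_sets[of "(+) (c i)" borel borel "A i"] by simp
    have em: "emeasure lborel (?B i) = emeasure lborel (A i)" if "i \<in> I" for i
      using A[OF that] lborel_distr_plus[of "c i"]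
        emeasure_distr[of "(+) (c i)" lborel borel "A i"] by simp
    have "(\<lambda>x. \<lambda>i\<in>I. x i + c i) -` Pi\<^sub>E I A \<inter> space (\<Pi>\<^sub>M i\<in>I. lborel) = Pi\<^sub>E I ?B"
      by (auto simp: space_PiM PiE_iff add.commute)
    moreover have "Pi\<^sub>E I A \<in> sets (\<Pi>\<^sub>M i\<in>I. lborel)"
      using A I by (intro sets_PiM_I_finite)
    ultimately show "emeasure (distr (\<Pi>\<^sub>M i\<in>I. lborel) (\<Pi>\<^sub>M i\<in>I. lborel) (\<lambda>x. \<lambda>i\<in>I. x i + c i)) (Pi\<^sub>E I A)
        = (\<Prod>i\<in>I. emeasure lborel (A i))"
      using emeasure_PiM[OF I, of ?B] B em by (simp add: emeasure_distr[OF T])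
  qed simp
qed

text \<open>By Fubini, some translate of the exceptional set is null, and hence so is the set itself.\<close>

lemma AE_PiM_lborel_if_AE_line:
  fixes c :: "'i \<Rightarrow> real"
  assumes I: "finite I" and P: "Measurable.pred (\<Pi>\<^sub>M i\<in>I. lborel) P"
    and line: "\<And>x. x \<in> space (\<Pi>\<^sub>M i\<in>I. lborel) \<Longrightarrow> AE s in lborel. P (\<lambda>i\<in>I. x i + s * c i)"
  shows "AE x in (\<Pi>\<^sub>M i\<in>I. (lborel :: real measure)). P x"
proof -
  let ?L = "\<Pi>\<^sub>M i\<in>I. (lborel :: real measure)"
  interpret product_sigma_finite "\<lambda>_::'i. lborel :: real measure" ..
  interpret L: finite_product_sigma_finite "\<lambda>_::'i. lborel :: real measure" I
    by standard (rule I)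
  interpret pair_sigma_finite ?L "lborel :: real measure" ..
  have T: "(\<lambda>z. \<lambda>i\<in>I. fst z i + snd z * c i) \<in> ?L \<Otimes>\<^sub>M lborel \<rightarrow>\<^sub>M ?L"
    by (intro measurable_restrict) measurable
  have "{z \<in> space (?L \<Otimes>\<^sub>M lborel). P (\<lambda>i\<in>I. fst z i + snd z * c i)} \<in> sets (?L \<Otimes>\<^sub>M lborel)"
    using measurable_compose[OF T P] by (simp add: pred_def)
  moreover have "AE x in ?L. AE s in lborel. P (\<lambda>i\<in>I. x i + s * c i)"
    using line by (rule AE_I2)
  ultimately have "AE s in lborel. AE x in ?L. P (\<lambda>i\<in>I. x i + s * c i)"
    by (rule AE_commute[THEN iffD1])
  \<comment> \<open>The line has positive measure, so what holds for almost every \<open>s\<close>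
    holds for at least one; this single \<open>s\<close> is enough for the translation
    argument.\<close>
  moreover have "ae_filter (lborel :: real measure) \<noteq> bot"
    by (simp add: ae_filter_eq_bot_iff)
  ultimately obtain s where "AE x in ?L. P (\<lambda>i\<in>I. x i + s * c i)"
    using eventually_happens by blast
  moreover have "(\<lambda>x. \<lambda>i\<in>I. x i + s * c i) \<in> ?L \<rightarrow>\<^sub>M ?L"
    by (intro measurable_restrict) measurable
  ultimately have "AE x in distr ?L ?L (\<lambda>x. \<lambda>i\<in>I. x i + s * c i). P x"
    using P by (subst AE_distr_iff) (auto simp: pred_def)
  then show ?thesis by (simp only: PiM_lborel_translation[OF I])
qed

section \<open>A continuous random matrix times a fixed matrix\<close>

text \<open>The determinant vanishes exactly when \<open>- s\<close> is an eigenvalue of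
  \<open>A\<close>, and the spectrum is finite.\<close>

lemma AE_det_add_scalar_nonzero:
  fixes A :: "complex mat"
  assumes A: "A \<in> carrier_mat n n"
  shows "AE s in lborel. Determinant.det (A + complex_of_real s \<cdot>\<^sub>m 1\<^sub>m n) \<noteq> 0"
proof -
  have "{s. Determinant.det (A + complex_of_real s \<cdot>\<^sub>m 1\<^sub>m n) = 0}
      = (\<lambda>s. - complex_of_real s) -` spectrum A"
    using A by (auto simp: spectrum_def eigenvalue_det[OF A] char_matrix_def)
  moreover have "finite ((\<lambda>s. - complex_of_real s) -` spectrum A)"
    by (intro finite_vimageI card_finite_spectrum[OF A]) (simp add: inj_def)
  ultimately have "{s. Determinant.det (A + complex_of_real s \<cdot>\<^sub>m 1\<^sub>m n) = 0} \<in> null_sets lborel"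
    by (simp add: finite_imp_null_set_lborel)
  from AE_not_in[OF this] show ?thesis by simp
qed

text \<open>A left inverse of \<open>re_im (m * n) \<circ> vec_of_mat\<close>: the entry \<open>(a, b)\<close> of an \<open>m \<times> n\<close> matrix
  sits at position \<open>b * m + a\<close> of its vectorization.\<close>

definition mat_of_re_im :: "nat \<Rightarrow> nat \<Rightarrow> (nat \<Rightarrow> real) \<Rightarrow> complex mat" where
  "mat_of_re_im m n x =
     Matrix.mat m n (\<lambda>(a, b). Complex (x (b * m + a)) (x (b * m + a + m * n)))"

lemma mat_of_re_im_carrier [simp]: "mat_of_re_im m n x \<in> carrier_mat m n"
  by (simp add: mat_of_re_im_def)

lemma vectorization_index_less:
  fixes a b m n :: nat
  assumes "a < m" "b < n"
  shows "b * m + a < m * n"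
proof -
  have "b * m + a < b * m + m" using assms by simp
  also have "\<dots> = Suc b * m" by simp
  also have "\<dots> \<le> n * m" using assms by (intro mult_le_mono) auto
  finally show ?thesis by (simp add: mult.commute)
qed

lemma mat_of_re_im_vec_of_mat:
  assumes A: "A \<in> carrier_mat m n"
  shows "mat_of_re_im m n (re_im (m * n) (vec_of_mat A)) = A"
proof (rule eq_matI)
  fix a b assume ab: "a < dim_row A" "b < dim_col A"
  then show "mat_of_re_im m n (re_im (m * n) (vec_of_mat A)) $$ (a, b) = A $$ (a, b)"
    using A vectorization_index_less[of a m b n]
    by (auto simp: mat_of_re_im_def re_im_def vec_of_mat_def)
qed (use A in \<open>auto simp: mat_of_re_im_def\<close>)

lemma measurable_mat_of_re_im:
  "mat_of_re_im m n \<in> (\<Pi>\<^sub>M k\<in>{..<2 * (m * n)}. lborel) \<rightarrow>\<^sub>M mat_borel m n"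
proof (rule measurable_mat_borelI)
  fix a b assume ab: "a < m" "b < n"
  then have "b * m + a < m * n" by (rule vectorization_index_less)
  then have "(\<lambda>x. Complex (x (b * m + a)) (x (b * m + a + m * n)))
      \<in> borel_measurable (\<Pi>\<^sub>M k\<in>{..<2 * (m * n)}. lborel)"
    unfolding Complex_eq
    by (intro borel_measurable_add borel_measurable_times borel_measurable_of_real
        borel_measurable_const) (measurable; simp)+
  then show "(\<lambda>x. mat_of_re_im m n x $$ (a, b))
      \<in> borel_measurable (\<Pi>\<^sub>M k\<in>{..<2 * (m * n)}. lborel)"
    using ab by (simp add: mat_of_re_im_def)
qed simp

text \<open>Moving \<open>X\<close> along the line \<open>X + s B\<close> turns \<open>det (X T)\<close> into \<open>det (X T + s I)\<close>, which has
  only finitely many zeros \<open>s\<close>.\<close>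

lemma AE_det_mult_nonzero:
  fixes T :: "complex mat"
  assumes T: "T \<in> carrier_mat n m" and B: "B \<in> carrier_mat m n" and BT: "B * T = 1\<^sub>m m"
  shows "AE x in (\<Pi>\<^sub>M k\<in>{..<2 * (m * n)}. lborel). Determinant.det (mat_of_re_im m n x * T) \<noteq> 0"
proof (rule AE_PiM_lborel_if_AE_line[where c = "re_im (m * n) (vec_of_mat B)"])
  let ?L = "\<Pi>\<^sub>M k\<in>{..<2 * (m * n)}. (lborel :: real measure)"
  let ?c = "re_im (m * n) (vec_of_mat B)"
  have "(\<lambda>x. mat_of_re_im m n x * T) \<in> ?L \<rightarrow>\<^sub>M mat_borel m m"
    by (rule measurable_mat_mult[OF measurable_mat_of_re_im]) (simp add: T)
  from borel_measurable_det[OF this]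
  show "Measurable.pred ?L (\<lambda>x. Determinant.det (mat_of_re_im m n x * T) \<noteq> 0)"
    by measurable
  fix x :: "nat \<Rightarrow> real"
  have "mat_of_re_im m n (\<lambda>k\<in>{..<2 * (m * n)}. x k + s * ?c k) * T
      = mat_of_re_im m n x * T + complex_of_real s \<cdot>\<^sub>m 1\<^sub>m m" for s
  proof -
    have "mat_of_re_im m n (\<lambda>k\<in>{..<2 * (m * n)}. x k + s * ?c k)
        = mat_of_re_im m n x + complex_of_real s \<cdot>\<^sub>m mat_of_re_im m n ?c"
      by (intro eq_matI)
        (auto simp: mat_of_re_im_def complex_eq_iff mult_2 intro!: trans_less_add1
          dest: vectorization_index_less)
    also have "\<dots> = mat_of_re_im m n x + complex_of_real s \<cdot>\<^sub>m B"
      by (simp only: mat_of_re_im_vec_of_mat[OF B])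
    also have "\<dots> * T = mat_of_re_im m n x * T + (complex_of_real s \<cdot>\<^sub>m B) * T"
      using B T by (intro add_mult_distrib_mat) auto
    also have "(complex_of_real s \<cdot>\<^sub>m B) * T = complex_of_real s \<cdot>\<^sub>m (B * T)"
      using B T by (intro mult_smult_assoc_mat)
    finally show ?thesis unfolding BT .
  qed
  moreover have "mat_of_re_im m n x * T \<in> carrier_mat m m"
    using T by (meson mat_of_re_im_carrier mult_carrier_mat)
  ultimately show "AE s in lborel.
      Determinant.det (mat_of_re_im m n (\<lambda>k\<in>{..<2 * (m * n)}. x k + s * ?c k) * T) \<noteq> 0"
    using AE_det_add_scalar_nonzero by simp
qed simp

text \<open>The law of the real coordinates of \<open>X\<close> has a density, so Lebesgue null sets
  are null for it. The statement for Lebesgue measure is thus pulled back along the coordinate map,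
  and \<open>mat_of_re_im\<close> recovers \<open>X\<close> from its coordinates.\<close>

lemma continuous_AE_det_mult_nonzero:
  assumes cont: "continuous_rvec M (m * n) (\<lambda>\<omega>. vec_of_mat (X \<omega>))"
    and X: "X \<in> M \<rightarrow>\<^sub>M mat_borel m n"
    and T: "T \<in> carrier_mat n m" and B: "B \<in> carrier_mat m n" and BT: "B * T = 1\<^sub>m m"
  shows "AE \<omega> in M. Determinant.det (X \<omega> * T) \<noteq> 0"
proof -
  let ?L = "\<Pi>\<^sub>M k\<in>{..<2 * (m * n)}. (lborel :: real measure)"
  let ?R = "\<lambda>\<omega>. re_im (m * n) (vec_of_mat (X \<omega>))"
  from cont obtain f where f: "distr M ?L ?R = density ?L f" "f \<in> borel_measurable ?L"
    "?R \<in> M \<rightarrow>\<^sub>M ?L"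
    unfolding continuous_rvec_def distributed_def by auto
  have "AE x in distr M ?L ?R. Determinant.det (mat_of_re_im m n x * T) \<noteq> 0"
    unfolding f(1) AE_density[OF f(2)] using AE_det_mult_nonzero[OF T B BT] by auto
  from AE_distrD[OF f(3) this] AE_space show ?thesis
  proof eventually_elim
    case (elim \<omega>)
    then show ?case using mat_of_re_im_vec_of_mat measurable_space[OF X] by simp
  qed
qed

section \<open>Independence of two members of a family\<close>

text \<open>Restrictions of the family to the disjoint index sets \<open>{a}\<close> and
  \<open>{b}\<close> are independent; projecting each to its only coordinate yields the two
  variables.\<close>

lemma (in prob_space) indep_vars_imp_indep_var:
  assumes ind: "indep_vars N X I" and "a \<in> I" "b \<in> I" "a \<noteq> b"
  shows "indep_var (N a) (X a) (N b) (X b)"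
proof -
  have "indep_var (PiM {a} N) (\<lambda>\<omega>. \<lambda>i\<in>{a}. X i \<omega>) (PiM {b} N) (\<lambda>\<omega>. \<lambda>i\<in>{b}. X i \<omega>)"
    using assms by (intro indep_var_restrict[OF ind]) auto
  then have "indep_var (N a) ((\<lambda>x. x a) \<circ> (\<lambda>\<omega>. \<lambda>i\<in>{a}. X i \<omega>))
      (N b) ((\<lambda>x. x b) \<circ> (\<lambda>\<omega>. \<lambda>i\<in>{b}. X i \<omega>))"
    by (rule indep_var_compose) (auto intro!: measurable_component_singleton)
  then show ?thesis by (simp add: comp_def)
qed

section \<open>Orthonormal columns and left inverses\<close>

lemma gram_carrier: "A \<in> carrier_mat n m \<Longrightarrow> gram A \<in> carrier_mat m m"
  unfolding gram_def by (meson mat_adjoint_carrier mult_carrier_mat)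

lemma gram_index:
  assumes "A \<in> carrier_mat n m" "a < m" "b < m"
  shows "gram A $$ (a, b) = (\<Sum>l = 0..<n. conjugate (A $$ (l, a)) * A $$ (l, b))"
  using assms by (auto simp: gram_def scalar_prod_def mat_adjoint_index)

text \<open>\<open>gram A\<close> collects the inner products of the columns of \<open>A\<close>, so
  its being the identity means that they are orthonormal. A selection without repetition stays
  orthonormal; injectivity of \<open>f\<close> is what makes the off-diagonal entries zero.\<close>

lemma gram_select_cols:
  assumes A: "A \<in> carrier_mat n m" and gram: "gram A = 1\<^sub>m m" and C: "C \<in> carrier_mat n k"
    and f: "inj_on f {..<k}" "f ` {..<k} \<subseteq> {..<m}"
    and CA: "\<And>l b. l < n \<Longrightarrow> b < k \<Longrightarrow> C $$ (l, b) = A $$ (l, f b)"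
  shows "gram C = 1\<^sub>m k"
proof (rule eq_matI)
  fix a b assume "a < dim_row (1\<^sub>m k :: complex mat)" "b < dim_col (1\<^sub>m k :: complex mat)"
  then have ab: "a < k" "b < k" by auto
  then have fab: "f a < m" "f b < m" using f(2) by auto
  have "gram C $$ (a, b) = gram A $$ (f a, f b)"
    using ab fab by (simp add: gram_index[OF C] gram_index[OF A] CA)
  also have "\<dots> = 1\<^sub>m k $$ (a, b)"
    using ab fab inj_onD[OF f(1), of a b] by (auto simp: gram)
  finally show "gram C $$ (a, b) = 1\<^sub>m k $$ (a, b)" .
qed (use gram_carrier[OF C] in auto)

text \<open>Its columns are distinct columns of a unitary matrix.\<close>

lemma gram_precoder:
  assumes U: "unitary_mat n (W G)" and q: "selects_null_columns n k G (W G) (q G)"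
  shows "gram (precoder n k W q G) = 1\<^sub>m k"
proof (rule gram_select_cols)
  show "W G \<in> carrier_mat n n" "gram (W G) = 1\<^sub>m n"
    using U by (auto simp: unitary_mat_def gram_def)
  show "inj_on (q G) {..<k}" "q G ` {..<k} \<subseteq> {..<n}"
    using q by (auto simp: selects_null_columns_def)
  then show "precoder n k W q G $$ (l, b) = W G $$ (l, q G b)" if "l < n" "b < k" for l b
    using that \<open>W G \<in> carrier_mat n n\<close> by (auto simp: precoder_def mat_of_cols_index)
qed (auto simp: precoder_def)

text \<open>For \<open>k \<le> n\<close>, right multiplication by this matrix keeps the first
  \<open>k\<close> columns. Writing truncation as a product makes it measurable and lets
  associativity move it through other products.\<close>

definition first_cols :: "nat \<Rightarrow> nat \<Rightarrow> complex mat" where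
  "first_cols n k = Matrix.mat n k (\<lambda>(a, b). if a = b then 1 else 0)"

lemma first_cols_carrier [simp]: "first_cols n k \<in> carrier_mat n k"
  by (simp add: first_cols_def)

lemma gram_mult_first_cols:
  assumes T: "T \<in> carrier_mat n m" and gram: "gram T = 1\<^sub>m m" and k: "k \<le> m"
  shows "gram (T * first_cols m k) = 1\<^sub>m k"
proof (rule gram_select_cols[OF T gram, where f = "\<lambda>b. b"])
  show "(T * first_cols m k) $$ (l, b) = T $$ (l, b)" if "l < n" "b < k" for l b
    using that T k by (auto simp: first_cols_def scalar_prod_def if_distrib cong: if_cong)
qed (use T k in \<open>auto simp: first_cols_def\<close>)

text \<open>The witness is the pseudoinverse \<open>C * mat_adjoint T\<close>, where
  \<open>C\<close> inverts \<open>gram T\<close>.\<close>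

lemma left_inverse_if_det_gram_nonzero:
  assumes T: "T \<in> carrier_mat n m" and det: "Determinant.det (gram T) \<noteq> 0"
  obtains B where "B \<in> carrier_mat m n" "B * T = 1\<^sub>m m"
proof -
  from det_non_zero_imp_unit[OF gram_carrier[OF T] det, of "()"]
  obtain C where C: "C \<in> carrier_mat m m" "C * gram T = 1\<^sub>m m"
    unfolding Units_def ring_mat_def by auto
  show ?thesis
  proof (rule that)
    show "C * mat_adjoint T \<in> carrier_mat m n"
      using C(1) mat_adjoint_carrier[OF T] by (rule mult_carrier_mat)
    show "C * mat_adjoint T * T = 1\<^sub>m m"
      using assoc_mult_mat[OF C(1) mat_adjoint_carrier[OF T] T] C(2) by (simp add: gram_def)
  qed
qed

section \<open>The random pre-coding matrix and almost sure full rank\<close>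

text \<open>By independence the joint law of \<open>X\<close> and \<open>T\<close> is a product
  measure, so Fubini reduces the claim to a fixed value of \<open>T\<close>.\<close>

lemma (in prob_space) indep_AE_det_mult_nonzero:
  assumes ind: "indep_var (mat_borel m n) X (mat_borel n k) T"
    and cont: "continuous_rvec M (m * n) (\<lambda>\<omega>. vec_of_mat (X \<omega>))"
    and gram: "\<And>\<omega>. \<omega> \<in> space M \<Longrightarrow> gram (T \<omega>) = 1\<^sub>m k" and "m \<le> k"
  shows "AE \<omega> in M. Determinant.det (X \<omega> * (T \<omega> * first_cols k m)) \<noteq> 0"
proof -
  let ?A = "mat_borel m n" and ?B = "mat_borel n k"
  let ?E = "first_cols k m"
  \<comment> \<open>Fubini ranges over all matrices \<open>C\<close>, not only over values of
    \<open>T\<close>. The premise restricts the claim to those with a left inverse of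
    \<open>C * ?E\<close>, and as a determinant condition it is plainly measurable.\<close>
  let ?P = "\<lambda>z. Determinant.det (gram (snd z * ?E)) \<noteq> 0 \<longrightarrow>
      Determinant.det (fst z * (snd z * ?E)) \<noteq> 0"
  have X: "X \<in> M \<rightarrow>\<^sub>M ?A" and T: "T \<in> M \<rightarrow>\<^sub>M ?B"
    using indep_var_rv1[OF ind] indep_var_rv2[OF ind] by auto
  have pair: "distr M ?A X \<Otimes>\<^sub>M distr M ?B T = distr M (?A \<Otimes>\<^sub>M ?B) (\<lambda>\<omega>. (X \<omega>, T \<omega>))"
    using ind unfolding indep_var_distribution_eq by blast
  interpret DX: prob_space "distr M ?A X" using X by (rule prob_space_distr)
  interpret DT: prob_space "distr M ?B T" using T by (rule prob_space_distr)
  interpret P: pair_sigma_finite "distr M ?A X" "distr M ?B T" ..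
  have TE: "(\<lambda>z. snd z * ?E) \<in> ?A \<Otimes>\<^sub>M ?B \<rightarrow>\<^sub>M mat_borel n m"
    by (rule measurable_mat_mult[OF measurable_snd]) simp
  have "(\<lambda>z. Determinant.det (gram (snd z * ?E))) \<in> borel_measurable (?A \<Otimes>\<^sub>M ?B)"
    by (rule borel_measurable_det[OF measurable_compose[OF TE measurable_gram]])
  moreover have "(\<lambda>z. Determinant.det (fst z * (snd z * ?E))) \<in> borel_measurable (?A \<Otimes>\<^sub>M ?B)"
    by (rule borel_measurable_det[OF measurable_mat_mult[OF measurable_fst TE]])
  ultimately have "Measurable.pred (?A \<Otimes>\<^sub>M ?B) ?P" by measurable
  then have meas: "{z \<in> space (distr M ?A X \<Otimes>\<^sub>M distr M ?B T). ?P z}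
      \<in> sets (distr M ?A X \<Otimes>\<^sub>M distr M ?B T)"
    by (simp add: pred_def space_pair_measure cong: sets_pair_measure_cong)
  have "AE C in distr M ?B T. AE A in distr M ?A X. ?P (A, C)"
  proof (rule AE_I2)
    fix C assume "C \<in> space (distr M ?B T)"
    then have CE: "C * ?E \<in> carrier_mat n m"
      using mult_carrier_mat[OF _ first_cols_carrier] by simp
    show "AE A in distr M ?A X. ?P (A, C)"
    proof (cases "Determinant.det (gram (C * ?E)) = 0")
      case False
      then obtain B where B: "B \<in> carrier_mat m n" "B * (C * ?E) = 1\<^sub>m m"
        using left_inverse_if_det_gram_nonzero[OF CE] by blast
      have "(\<lambda>A. A * (C * ?E)) \<in> ?A \<rightarrow>\<^sub>M mat_borel m m"
        by (rule measurable_mat_mult[OF measurable_ident[unfolded id_def]]) (simp add: CE)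
      from borel_measurable_det[OF this]
      have "Measurable.pred ?A (\<lambda>A. Determinant.det (A * (C * ?E)) \<noteq> 0)"
        by measurable
      then have "AE A in distr M ?A X. Determinant.det (A * (C * ?E)) \<noteq> 0"
        using continuous_AE_det_mult_nonzero[OF cont X CE B]
        by (subst AE_distr_iff[OF X]) (simp_all add: pred_def)
      then show ?thesis by simp
    qed simp
  qed
  \<comment> \<open>The fixed-\<open>C\<close> statement has the law of \<open>T\<close> outermost;
    the order is swapped to match the product measure with \<open>X\<close> as first factor.\<close>
  then have "AE A in distr M ?A X. AE C in distr M ?B T. ?P (A, C)"
    using meas by (subst P.AE_commute) auto
  then have "AE z in distr M (?A \<Otimes>\<^sub>M ?B) (\<lambda>\<omega>. (X \<omega>, T \<omega>)). ?P z"
    unfolding pair[symmetric] using meas by (intro P.AE_pair_measure)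
  from AE_distrD[OF measurable_Pair[OF X T] this] AE_space show ?thesis
  proof eventually_elim
    case (elim \<omega>)
    \<comment> \<open>Orthonormal columns discharge the premise of \<open>?P\<close>, since the
      identity has determinant one.\<close>
    have "gram (T \<omega> * ?E) = 1\<^sub>m m"
      using gram_mult_first_cols[OF _ gram[OF elim(2)] \<open>m \<le> k\<close>] measurable_space[OF T elim(2)]
      by simp
    with elim(1) show ?case by simp
  qed
qed

theorem theorem3:
  fixes M :: "'a measure" and t r :: "nat \<Rightarrow> nat"
    and H :: "nat \<Rightarrow> nat \<Rightarrow> 'a \<Rightarrow> complex mat"
    and W L :: "complex mat \<Rightarrow> complex mat" and q :: "complex mat \<Rightarrow> nat \<Rightarrow> nat"
    and i j :: nat
  assumes "prob_space M"
    and "\<And>p. p \<in> {1, 2} \<Longrightarrow> t p > 0" and "\<And>p. p \<in> {1, 2} \<Longrightarrow> r p > 0"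
    and "prob_space.indep_vars M (\<lambda>(p, s). mat_borel (r p) (t s)) (\<lambda>(p, s). H p s)
           ({1, 2} \<times> {1, 2})"
    and "\<And>p. p \<in> {1, 2} \<Longrightarrow>
           continuous_rvec M (r p * t p) (\<lambda>\<omega>. vec_of_mat (H p p \<omega>))"
    and "i \<in> {1, 2}" and "j \<in> {1, 2}" and "i \<noteq> j" and "t i > r j"
    and "\<And>\<omega>. \<omega> \<in> space M \<Longrightarrow>
           eigenvalue_decomposition (t i) (gram (H j i \<omega>))
             (W (gram (H j i \<omega>))) (L (gram (H j i \<omega>)))"
    and "\<And>\<omega>. \<omega> \<in> space M \<Longrightarrow>
           selects_null_columns (t i) (t i - r j) (gram (H j i \<omega>))
             (W (gram (H j i \<omega>))) (q (gram (H j i \<omega>)))"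
    and "precoder (t i) (t i - r j) W q
           \<in> mat_borel (t i) (t i) \<rightarrow>\<^sub>M mat_borel (t i) (t i - r j)"
    and "t i \<ge> r i + r j"
  shows "AE \<omega> in M. vec_space.rank (r i) (H i i \<omega>) =
           vec_space.rank (r i)
             (H i i \<omega> * precoder (t i) (t i - r j) W q (gram (H j i \<omega>)))"
proof -
  interpret prob_space M by fact
  let ?k = "t i - r j"
  let ?T = "\<lambda>\<omega>. precoder (t i) ?k W q (gram (H j i \<omega>))"
  have "indep_var (mat_borel (r i) (t i)) (H i i) (mat_borel (r j) (t i)) (H j i)"
    using indep_vars_imp_indep_var[OF assms(4), of "(i, i)" "(j, i)"] assms(6-8) by auto
  \<comment> \<open>The pre-coding matrix is a measurable function of \<open>H j i\<close>, which is
    independent of \<open>H i i\<close> because \<open>i \<noteq> j\<close>.\<close>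
  from indep_var_compose[OF this measurable_ident measurable_compose[OF measurable_gram assms(12)]]
  have ind: "indep_var (mat_borel (r i) (t i)) (H i i) (mat_borel (t i) ?k) ?T"
    by (simp add: comp_def id_def)
  have gram: "gram (?T \<omega>) = 1\<^sub>m ?k" if "\<omega> \<in> space M" for \<omega>
    using gram_precoder assms(10,11)[OF that] by (auto simp: eigenvalue_decomposition_def)
  \<comment> \<open>The dimension condition leaves at least \<open>r i\<close> pre-coding columns,
    so truncation to a square product is possible.\<close>
  have le: "r i \<le> ?k" using assms(13) by simp
  have "AE \<omega> in M. Determinant.det (H i i \<omega> * (?T \<omega> * first_cols ?k (r i))) \<noteq> 0"
    using ind assms(5)[OF assms(6)] gram le by (rule indep_AE_det_mult_nonzero)
  from this AE_space show ?thesis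
  proof eventually_elim
    case (elim \<omega>)
    let ?E = "first_cols ?k (r i)"
    have H: "H i i \<omega> \<in> carrier_mat (r i) (t i)" and T: "?T \<omega> \<in> carrier_mat (t i) ?k"
      using measurable_space[OF indep_var_rv1[OF ind] elim(2)]
        measurable_space[OF indep_var_rv2[OF ind] elim(2)] by simp_all
    \<comment> \<open>The same nonzero determinant serves both ranks: here
      \<open>?T \<omega> * ?E\<close> is the right factor, and below, after reassociating,
      \<open>?E\<close> alone.\<close>
    have "vec_space.rank (r i) (H i i \<omega>) = r i"
      using H mult_carrier_mat[OF T first_cols_carrier] elim(1) by (rule rank_eq_if_det_nonzero)
    moreover have "vec_space.rank (r i) (H i i \<omega> * ?T \<omega>) = r i"
      using mult_carrier_mat[OF H T] first_cols_carrier
    proof (rule rank_eq_if_det_nonzero)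
      show "Determinant.det (H i i \<omega> * ?T \<omega> * ?E) \<noteq> 0"
        using elim(1) assoc_mult_mat[OF H T first_cols_carrier] by simp
    qed
    ultimately show ?case by simp
  qed
qed

end
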